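(* Let $k,m\in\mathbb{N}$, $p\in(0,2]$ and $\lambda\in(0,\infty)$, and let $R_3=R^{k,m}_{\lambda,p}$ be the unique root in $(0,1)$ of the equation $\Psi_3(r)=0$, where $$\Psi_3(r)=p\,\frac{1-r^m}{1+r^m}-2\lambda\frac{r^k}{1-r^k}.$$ Let $f(z)=\sum_{j=0}^\infty a_jz^j\in\mathcal{B}$ and let $\omega_n\in\mathcal{B}_n$ for $n\ge1$. Then $$C_f(z):=|f(\omega_m(z))|^p+\lambda\Big[B_1(f,|\omega_k(z)|)+A(f_0,|\omega_k(z)|)\Big]\le1\qquad\text{for }0\le|z|=r\le R_3 .$$ The radius $R_3$ is best possible: for every $R\in(R_3,1)$ there exist such $f$ and $\omega_n$ ($n\ge1$) and a point $z$ with $|z|\le R$ such that $C_f(z)>1$.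
   Context: $\mathbb{N}=\{1,2,\dots\}$ and $\mathbb{D}=\{z\in\mathbb{C}:|z|<1\}$. $\mathcal{B}$ is the class of analytic functions $f$ on $\mathbb{D}$ with $\sup_{z\in\mathbb{D}}|f(z)|\le 1$. For $n\in\mathbb{N}$, $\mathcal{B}_n=\{\omega\in\mathcal{B}:\omega(0)=\cdots=\omega^{(n-1)}(0)=0,\ \omega^{(n)}(0)\ne0\}$. For $f(z)=\sum_{n\ge0}a_nz^n\in\mathcal{B}$, $f_0(z)=f(z)-f(0)$ and $0\le\rho<1$, put $$B_1(f,\rho)=\sum_{n=1}^\infty|a_n|\rho^n,\qquad A(f_0,\rho)=\Big(\frac1{1+|a_0|}+\frac{\rho}{1-\rho}\Big)\sum_{n=1}^\infty|a_n|^2\rho^{2n}.$$ *)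

theory Defs
  imports "HOL-Complex_Analysis.Complex_Analysis"
begin

definition class_B :: "(complex \<Rightarrow> complex) set" where
  "class_B = {f. f holomorphic_on ball 0 1 \<and> (\<forall>z\<in>ball 0 1. cmod (f z) \<le> 1)}"

definition class_Bn :: "nat \<Rightarrow> (complex \<Rightarrow> complex) set" where
  "class_Bn n = {\<omega> \<in> class_B. (\<forall>j<n. (deriv ^^ j) \<omega> 0 = 0) \<and> (deriv ^^ n) \<omega> 0 \<noteq> 0}"

definition taylor_coeff :: "(complex \<Rightarrow> complex) \<Rightarrow> nat \<Rightarrow> complex" where
  "taylor_coeff f n = (deriv ^^ n) f 0 / fact n"

(* In the next two definitions the summation index is shifted, so that the sums start at the
   coefficient of index 1. Both series converge for f in class_B and 0 \<le> \<rho> < 1. *)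

definition B1 :: "(complex \<Rightarrow> complex) \<Rightarrow> real \<Rightarrow> real" where
  "B1 f \<rho> = (\<Sum>n. cmod (taylor_coeff f (Suc n)) * \<rho> ^ Suc n)"

(* The argument is f itself: A0 f stands for A(f_0, -) with f_0 = f - f(0). The coefficients of
   index at least 1 agree for f and f_0, while a_0 is the constant coefficient of f. *)

definition A0 :: "(complex \<Rightarrow> complex) \<Rightarrow> real \<Rightarrow> real" where
  "A0 f \<rho> = (1 / (1 + cmod (taylor_coeff f 0)) + \<rho> / (1 - \<rho>)) *
     (\<Sum>n. (cmod (taylor_coeff f (Suc n)))\<^sup>2 * \<rho> ^ (2 * Suc n))"

definition Psi3 :: "nat \<Rightarrow> nat \<Rightarrow> real \<Rightarrow> real \<Rightarrow> real \<Rightarrow> real" where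
  "Psi3 k m lam p r = p * ((1 - r ^ m) / (1 + r ^ m)) - 2 * lam * (r ^ k / (1 - r ^ k))"

definition R3 :: "nat \<Rightarrow> nat \<Rightarrow> real \<Rightarrow> real \<Rightarrow> real" where
  "R3 k m lam p = (THE r. 0 < r \<and> r < 1 \<and> Psi3 k m lam p r = 0)"

definition C_fun :: "nat \<Rightarrow> nat \<Rightarrow> real \<Rightarrow> real \<Rightarrow> (complex \<Rightarrow> complex) \<Rightarrow>
    (nat \<Rightarrow> complex \<Rightarrow> complex) \<Rightarrow> complex \<Rightarrow> real" where
  "C_fun k m lam p f \<omega> z =
     cmod (f (\<omega> m z)) powr p + lam * (B1 f (cmod (\<omega> k z)) + A0 f (cmod (\<omega> k z)))"

end

theory Submission
  imports Defs
begin

text \<open>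
  Pairing \<open>f\<close> with the square of a polynomial \<open>p\<close> on circles of radius tending to \<open>1\<close> gives
  \<open>Re (\<Sum>i j. p\<^sub>i p\<^sub>j a\<^bsub>N-i-j\<^esub>) \<le> \<Sum>i. \<bar>p\<^sub>i\<bar>\<^sup>2\<close>.
  A suitable \<open>p\<close>, together with a rotation of \<open>f\<close>, yields Carlson's coefficient inequalities: \<open>\<bar>a\<^sub>N\<bar>\<close>
  is at most \<open>1 - \<Sum>\<close> of the \<open>\<bar>a\<^sub>i\<bar>\<^sup>2\<close> with \<open>2i < N\<close>, and for even \<open>N = 2n\<close> one may also subtract
  \<open>\<bar>a\<^sub>n\<bar>\<^sup>2 / (1 + \<bar>a\<^sub>0\<bar>)\<close>. Weighting them with \<open>\<rho>\<^sup>N\<close> and summing, the subtracted terms add up to exactly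
  \<open>A(f\<^sub>0, \<rho>)\<close>, so \<open>B\<^sub>1 + A \<le> (1 - \<bar>a\<^sub>0\<bar>\<^sup>2) \<rho> / (1 - \<rho>)\<close>. With the Schwarz and Schwarz--Pick lemmas the
  claim becomes a scalar inequality, which follows from \<open>1 - x\<^sup>p \<ge> (p/2)(1 - x\<^sup>2)\<close> for \<open>p \<le> 2\<close>.
  For sharpness take \<open>\<omega>\<^sub>n(z) = z\<^sup>n\<close> and \<open>f(z) = (a + z) / (1 + az)\<close>: the resulting lower bound for \<open>C\<^sub>f(R)\<close>
  equals \<open>1\<close> at \<open>a = 1\<close> and has derivative \<open>\<Psi>\<^sub>3(R) < 0\<close> in \<open>a\<close> there.
\<close>

subsection \<open>A quadratic form in the Taylor coefficients\<close>

text \<open>Multiplication by \<open>z ^ i\<close> shifts the formal power series. The value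
  \<open>0\<close> for \<open>i > N\<close> lets later double sums run over all indices.\<close>

lemma taylor_coeff_power_mult:
  assumes "f holomorphic_on ball 0 1"
  shows "taylor_coeff (\<lambda>z. z ^ i * f z) N = (if i \<le> N then taylor_coeff f (N - i) else 0)"
proof -
  have F: "f has_fps_expansion fps_expansion f 0"
    using assms by (intro has_fps_expansion_fps_expansion[of "ball 0 1"]) auto
  have "(\<lambda>z. z ^ i * f z) has_fps_expansion fps_X ^ i * fps_expansion f 0"
    by (intro fps_expansion_intros F)
  then have "fps_nth (fps_X ^ i * fps_expansion f 0) N = taylor_coeff (\<lambda>z. z ^ i * f z) N"
    by (simp add: taylor_coeff_def fps_nth_fps_expansion)
  moreover have "fps_nth (fps_expansion f 0) n = taylor_coeff f n" for n
    by (simp add: taylor_coeff_def fps_expansion_def)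
  ultimately show ?thesis
    by (auto simp: fps_X_power_mult_nth split: if_splits)
qed

text \<open>Cauchy's formula for higher derivatives, with the circle parametrised by
  \<open>{0..1}\<close>: \<open>dz = 2 * pi * \<i> * z dt\<close> absorbs one power of
  \<open>z\<close> from the denominator.\<close>

lemma taylor_coeff_integral:
  assumes "f holomorphic_on ball 0 1" and r: "0 < r" "r < 1"
  shows "((\<lambda>t. f (circlepath 0 r t) / circlepath 0 r t ^ N) has_integral taylor_coeff f N) {0..1}"
proof -
  have "continuous_on (cball 0 r) f" "f holomorphic_on ball 0 r"
    using r by (auto intro!: holomorphic_on_imp_continuous_on holomorphic_on_subset[OF assms(1)])
  from Cauchy_has_contour_integral_higher_derivative_circlepath[OF this, of 0 N] r
  have "((\<lambda>x. f (circlepath 0 r x) / (circlepath 0 r x) ^ Suc N *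
      (2 * pi * \<i> * r * exp (2 * of_real pi * \<i> * x))) has_integral
      2 * pi * \<i> / fact N * (deriv ^^ N) f 0) {0..1}"
    by (simp add: has_contour_integral vector_derivative_circlepath)
  then have "((\<lambda>x. 1 / (2 * pi * \<i>) * (f (circlepath 0 r x) / (circlepath 0 r x) ^ Suc N *
      (2 * pi * \<i> * r * exp (2 * of_real pi * \<i> * x)))) has_integral
      1 / (2 * pi * \<i>) * (2 * pi * \<i> / fact N * (deriv ^^ N) f 0)) {0..1}"
    by (rule has_integral_mult_right)
  moreover have "1 / (2 * pi * \<i>) * (2 * pi * \<i> / fact N * (deriv ^^ N) f 0) = taylor_coeff f N"
    by (simp add: taylor_coeff_def)
  moreover have "1 / (2 * pi * \<i>) * (f (circlepath 0 r x) / (circlepath 0 r x) ^ Suc N *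
      (2 * pi * \<i> * r * exp (2 * of_real pi * \<i> * x))) =
      f (circlepath 0 r x) / circlepath 0 r x ^ N" for x
    using r by (simp add: circlepath field_simps)
  ultimately show ?thesis
    by simp
qed

lemma taylor_coeff_moment:
  assumes "f holomorphic_on ball 0 1" and r: "0 < r" "r < 1"
  shows "((\<lambda>t. circlepath 0 r t ^ i * f (circlepath 0 r t) / circlepath 0 r t ^ N) has_integral
    (if i \<le> N then taylor_coeff f (N - i) else 0)) {0..1}"
  using taylor_coeff_integral[of "\<lambda>z. z ^ i * f z" r N] assms
  by (simp add: taylor_coeff_power_mult holomorphic_intros)

lemma taylor_coeff_one: "taylor_coeff (\<lambda>_. 1) n = (if n = 0 then 1 else 0)"
  by (simp add: taylor_coeff_def)

text \<open>The moment formula for the constant function \<open>1\<close> is the orthogonality of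
  the powers of \<open>z\<close> on the circle, so only the diagonal terms survive.\<close>

lemma parseval_polynomial:
  fixes p :: "nat \<Rightarrow> complex"
  assumes r: "0 < r" "r < 1"
  shows "((\<lambda>t. (cmod (\<Sum>i\<le>N. p i * circlepath 0 r t ^ i))\<^sup>2) has_integral
    (\<Sum>i\<le>N. (cmod (p i))\<^sup>2 * r ^ (2 * i))) {0..1}"
proof -
  \<comment> \<open>On the circle, conjugate powers are multiples of negative powers, so the
    expanded square is a combination of moments.\<close>
  have cnj: "cnj (circlepath 0 r t) = of_real (r\<^sup>2) / circlepath 0 r t" for t
    using r by (simp add: circlepath exp_cnj power2_eq_square exp_minus field_simps)
  have "((\<lambda>t. \<Sum>i\<le>N. \<Sum>j\<le>N. p i * cnj (p j) * of_real (r\<^sup>2) ^ j *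
      (circlepath 0 r t ^ i * 1 / circlepath 0 r t ^ j)) has_integral
      (\<Sum>i\<le>N. \<Sum>j\<le>N. p i * cnj (p j) * of_real (r\<^sup>2) ^ j *
      (if i \<le> j then taylor_coeff (\<lambda>_. 1) (j - i) else 0))) {0..1}"
    by (intro has_integral_sum has_integral_mult_right taylor_coeff_moment r)
      auto
  moreover have "(\<Sum>i\<le>N. \<Sum>j\<le>N. p i * cnj (p j) * of_real (r\<^sup>2) ^ j *
      (if i \<le> j then taylor_coeff (\<lambda>_. 1) (j - i) else 0)) =
      complex_of_real (\<Sum>i\<le>N. (cmod (p i))\<^sup>2 * r ^ (2 * i))"
  proof -
    have "(if i \<le> j then taylor_coeff (\<lambda>_. 1) (j - i) else 0) = (if i = j then 1 else 0)"
      for i j :: nat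
      by (auto simp: taylor_coeff_one)
    then show ?thesis
      by (simp del: of_real_power add: of_real_power[of "r\<^sup>2"] if_distrib[of "\<lambda>x. _ * x"]
          power_mult complex_norm_square cong: if_cong)
  qed
  moreover have "(\<Sum>i\<le>N. \<Sum>j\<le>N. p i * cnj (p j) * of_real (r\<^sup>2) ^ j *
      (circlepath 0 r t ^ i * 1 / circlepath 0 r t ^ j)) =
      complex_of_real ((cmod (\<Sum>i\<le>N. p i * circlepath 0 r t ^ i))\<^sup>2)" for t
    unfolding complex_norm_square
    by (simp add: cnj sum_product power_divide mult_ac)
  ultimately have "((\<lambda>t. complex_of_real ((cmod (\<Sum>i\<le>N. p i * circlepath 0 r t ^ i))\<^sup>2)) has_integral
    complex_of_real (\<Sum>i\<le>N. (cmod (p i))\<^sup>2 * r ^ (2 * i))) {0..1}"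
    by simp
  from has_integral_Re[OF this] show ?thesis
    by simp
qed

text \<open>The form is the mean of \<open>P\<^sup>2 f / z ^ N\<close> over a circle of radius
  \<open>r\<close>, whose modulus is at most that of \<open>P\<^sup>2 / z ^ N\<close> because
  \<open>f\<close> is bounded by 1.\<close>

lemma class_B_quadratic_form:
  fixes p :: "nat \<Rightarrow> complex"
  assumes f: "f \<in> class_B"
  shows "Re (\<Sum>i\<le>N. \<Sum>j\<le>N. p i * p j * (if i + j \<le> N then taylor_coeff f (N - (i + j)) else 0))
    \<le> (\<Sum>i\<le>N. (cmod (p i))\<^sup>2)" (is "Re ?Q \<le> _")
proof -
  have hol: "f holomorphic_on ball 0 1" and bd: "\<And>z. cmod z < 1 \<Longrightarrow> cmod (f z) \<le> 1"
    using f by (auto simp: class_B_def)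
  have le: "Re ?Q \<le> (\<Sum>i\<le>N. (cmod (p i))\<^sup>2 * r ^ (2 * i)) / r ^ N" if r: "0 < r" "r < 1" for r
  proof -
    define P where "P t = (\<Sum>i\<le>N. p i * circlepath 0 r t ^ i)" for t
    have "((\<lambda>t. \<Sum>i\<le>N. \<Sum>j\<le>N. p i * p j * (circlepath 0 r t ^ (i + j) * f (circlepath 0 r t)
        / circlepath 0 r t ^ N)) has_integral ?Q) {0..1}"
      by (intro has_integral_sum has_integral_mult_right taylor_coeff_moment r hol) auto
    moreover have "(\<Sum>i\<le>N. \<Sum>j\<le>N. p i * p j * (circlepath 0 r t ^ (i + j) * f (circlepath 0 r t)
        / circlepath 0 r t ^ N)) = P t * P t * f (circlepath 0 r t) / circlepath 0 r t ^ N" for t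
      unfolding P_def sum_product by (simp add: sum_distrib_left sum_divide_distrib power_add mult_ac)
    ultimately have "((\<lambda>t. P t * P t * f (circlepath 0 r t) / circlepath 0 r t ^ N)
        has_integral ?Q) {0..1}"
      by simp
    note I = has_integral_Re[OF this]
    have J: "((\<lambda>t. (cmod (P t))\<^sup>2 / r ^ N) has_integral
        (\<Sum>i\<le>N. (cmod (p i))\<^sup>2 * r ^ (2 * i)) / r ^ N) {0..1}"
      unfolding P_def by (intro has_integral_divide parseval_polynomial r)
    show ?thesis
    proof (rule has_integral_le[OF I J])
      fix t :: real
      have n: "cmod (circlepath 0 r t) = r"
        using r by (simp add: circlepath norm_mult)
      have "Re (P t * P t * f (circlepath 0 r t) / circlepath 0 r t ^ N) \<le>
          cmod (P t * P t * f (circlepath 0 r t) / circlepath 0 r t ^ N)"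
        by (rule complex_Re_le_cmod)
      also have "\<dots> = (cmod (P t))\<^sup>2 / r ^ N * cmod (f (circlepath 0 r t))"
        by (simp add: norm_mult norm_divide norm_power n power2_eq_square)
      also have "\<dots> \<le> (cmod (P t))\<^sup>2 / r ^ N"
        using bd[of "circlepath 0 r t"] r n by (intro mult_left_le) auto
      finally show "Re (P t * P t * f (circlepath 0 r t) / circlepath 0 r t ^ N)
          \<le> (cmod (P t))\<^sup>2 / r ^ N" .
    qed
  qed
  \<comment> \<open>\<open>f\<close> is given only on the open disc, so \<open>r = 1\<close> is
    reached as a limit; the left side of the bound does not depend on \<open>r\<close>.\<close>
  have "((\<lambda>r. (\<Sum>i\<le>N. (cmod (p i))\<^sup>2 * r ^ (2 * i)) / r ^ N) \<longlongrightarrow>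
      (\<Sum>i\<le>N. (cmod (p i))\<^sup>2 * 1 ^ (2 * i)) / 1 ^ N) (at_left 1)"
    by (intro tendsto_intros) auto
  moreover have "\<forall>\<^sub>F r in at_left 1.
      Re ?Q \<le> (\<Sum>i\<le>N. (cmod (p i))\<^sup>2 * r ^ (2 * i)) / r ^ N"
    using eventually_at_left_real[OF zero_less_one] by (rule eventually_mono) (use le in auto)
  ultimately have "Re ?Q \<le> (\<Sum>i\<le>N. (cmod (p i))\<^sup>2 * 1 ^ (2 * i)) / 1 ^ N"
    by (rule tendsto_lowerbound) simp
  then show ?thesis
    by (simp only: power_one mult_1_right div_by_1)
qed

subsection \<open>Coefficient inequalities\<close>

lemma holomorphic_taylor_sums:
  assumes "f holomorphic_on ball 0 1" "cmod z < 1"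
  shows "(\<lambda>n. taylor_coeff f n * z ^ n) sums f z"
  using holomorphic_power_series[OF assms(1), of z] assms(2) by (simp add: taylor_coeff_def)

lemma taylor_coeff_cmult:
  assumes "f holomorphic_on ball 0 1"
  shows "taylor_coeff (\<lambda>z. c * f z) n = c * taylor_coeff f n"
  using higher_deriv_cmult[OF assms, of 0 n c] by (simp add: taylor_coeff_def)

text \<open>The reflection \<open>j \<mapsto> N - j\<close> carries the indices above
  \<open>N / 2\<close> to those below. It evaluates both the linear part of the form and the norm of
  the test vector.\<close>

lemma sum_upper_half:
  fixes g :: "nat \<Rightarrow> 'a::comm_monoid_add"
  assumes "N \<ge> 1"
  shows "(\<Sum>j\<le>N. if j = 0 then x else if N < 2 * j then g (N - j) else if N = 2 * j then y else 0)
    = x + (\<Sum>i | 2 * i < N. g i) + (if even N then y else 0)"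
proof -
  have "(\<Sum>j\<le>N. if j = 0 then x else if N < 2 * j then g (N - j) else if N = 2 * j then y else 0) =
    (\<Sum>j\<le>N. (if j = 0 then x else 0) + (if N < 2 * j then g (N - j) else 0)
      + (if j = N div 2 then if even N then y else 0 else 0))"
    using assms by (intro sum.cong) auto
  also have "\<dots> = x + (\<Sum>j\<le>N. if N < 2 * j then g (N - j) else 0) + (if even N then y else 0)"
    by (simp add: sum.distrib)
  also have "(\<Sum>j\<le>N. if N < 2 * j then g (N - j) else 0) = (\<Sum>j | j \<in> {..N} \<and> N < 2 * j. g (N - j))"
    by (rule sum.inter_filter[symmetric]) simp
  also have "\<dots> = (\<Sum>i | 2 * i < N. g i)"
    by (rule sum.reindex_bij_witness[of _ "\<lambda>i. N - i" "\<lambda>j. N - j"]) auto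
  finally show ?thesis .
qed

text \<open>
  In the quadratic form, \<open>p\<^sub>0 = 1\<close> and \<open>p\<^sub>i = cnj a\<^bsub>N-i\<^esub>\<close> for \<open>2i > N\<close>; no two indices of the latter kind
  interact because their sum exceeds \<open>N\<close>. For even \<open>N\<close> the middle entry \<open>c\<close> minimises
  \<open>(1 + \<bar>a\<^sub>0\<bar>) \<bar>c\<bar>\<^sup>2 - 2 Re (c a\<^bsub>N/2\<^esub>)\<close>.
\<close>

lemma class_B_coeff_bound:
  assumes f: "f \<in> class_B" and N: "N \<ge> 1"
  defines "a \<equiv> taylor_coeff f"
  shows "cmod (a N) \<le> 1 - (\<Sum>i | 2 * i < N. (cmod (a i))\<^sup>2)
    - (if even N then (cmod (a (N div 2)))\<^sup>2 / (1 + cmod (a 0)) else 0)"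
proof -
  have hol: "f holomorphic_on ball 0 1"
    using f by (auto simp: class_B_def)
  \<comment> \<open>The rotation that makes the \<open>N\<close>-th coefficient real and
    nonnegative; all moduli are preserved.\<close>
  define e where "e = (if a N = 0 then 1 else cnj (a N) / cmod (a N))"
  have e: "cmod e = 1" "e * a N = cmod (a N)"
    by (auto simp: e_def norm_divide complex_norm_square[symmetric] power2_eq_square
        mult.commute[of "cnj _"])
  define b where "b n = e * a n" for n
  have nb: "cmod (b n) = cmod (a n)" for n
    by (simp add: b_def norm_mult e)
  have b: "taylor_coeff (\<lambda>z. e * f z) n = b n" for n
    by (simp add: taylor_coeff_cmult hol b_def a_def)
  have ef: "(\<lambda>z. e * f z) \<in> class_B"
    using f by (auto simp: class_B_def norm_mult e intro!: holomorphic_intros)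
  define h where "h = N div 2"
  define c where "c = (if even N then cnj (b h) / (1 + cmod (a 0)) else 0)"
  define p where "p i = (if i = 0 then 1 else if N < 2 * i then cnj (b (N - i))
      else if N = 2 * i then c else 0)" for i
  define q where "q = (if even N then c\<^sup>2 * b 0 else 0)"
  define S where "S = (\<Sum>i | 2 * i < N. (cmod (a i))\<^sup>2)"
  define L where "L = (\<Sum>j\<le>N. p j * b (N - j))"
  let ?t = "\<lambda>i j. p i * p j * (if i + j \<le> N then b (N - (i + j)) else 0)"
  have p0: "p 0 = 1"
    by (simp add: p_def)
  have L: "L = b N + of_real S + (if even N then c * b h else 0)"
  proof -
    have "L = (\<Sum>j\<le>N. if j = 0 then b N else if N < 2 * j then of_real ((cmod (b (N - j)))\<^sup>2)
        else if N = 2 * j then c * b h else 0)"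
      unfolding L_def
      by (intro sum.cong) (auto simp: p_def h_def complex_norm_square mult.commute simp del: of_real_power)
    then show ?thesis
      using sum_upper_half[OF N, of "b N" "\<lambda>i. of_real ((cmod (b i))\<^sup>2)" "c * b h"]
      by (simp add: S_def nb)
  qed
  \<comment> \<open>For \<open>i, j \<ge> 1\<close> with \<open>p i\<close> and \<open>p j\<close>
    nonzero, \<open>i + j \<le> N\<close> forces \<open>i = j = N / 2\<close>; the only such product
    is \<open>q\<close>. The term \<open>j = 0\<close> mirrors row 0, so the linear part is counted
    twice.\<close>
  have row: "(\<Sum>j\<le>N. ?t i j) = p i * b (N - i) + (if i = h then q else 0)" if i: "i \<in> {1..N}" for i
  proof -
    have "(\<Sum>j\<le>N. ?t i j) = (\<Sum>j\<le>N. (if j = 0 then p i * b (N - i) else 0) +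
        (if j = h then if i = h then q else 0 else 0))"
    proof (intro sum.cong refl)
      fix j assume "j \<in> {..N}"
      show "?t i j = (if j = 0 then p i * b (N - i) else 0) +
        (if j = h then if i = h then q else 0 else 0)"
        using i N by (auto simp: p_def h_def q_def c_def power2_eq_square elim!: evenE)
    qed
    also have "\<dots> = p i * b (N - i) + (if i = h then q else 0)"
      using N by (simp add: sum.distrib h_def)
    finally show ?thesis .
  qed
  have "(\<Sum>i\<le>N. \<Sum>j\<le>N. ?t i j) = (\<Sum>j\<le>N. ?t 0 j) + (\<Sum>i=1..N. \<Sum>j\<le>N. ?t i j)"
    by (simp add: sum.atMost_shift sum.atLeast1_atMost_eq)
  also have "(\<Sum>j\<le>N. ?t 0 j) = L"
    unfolding L_def by (intro sum.cong) (auto simp: p0)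
  also have "(\<Sum>i=1..N. \<Sum>j\<le>N. ?t i j) = (\<Sum>i=1..N. p i * b (N - i) + (if i = h then q else 0))"
    by (intro sum.cong row) auto
  also have "\<dots> = (L - b N) + q"
  proof -
    have "L = p 0 * b N + (\<Sum>i=1..N. p i * b (N - i))"
      by (simp add: L_def sum.atMost_shift sum.atLeast1_atMost_eq)
    \<comment> \<open>For \<open>N = 1\<close> the index \<open>h = 0\<close> lies outside the
      range, but then \<open>N\<close> is odd and \<open>q = 0\<close>.\<close>
    moreover have "(\<Sum>i=1..N. if i = h then q else 0) = q"
      using N by (auto simp: h_def q_def)
    ultimately show ?thesis
      by (simp add: sum.distrib p0)
  qed
  finally have Q: "(\<Sum>i\<le>N. \<Sum>j\<le>N. ?t i j) = L + (L - b N + q)" .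
  have P: "(\<Sum>i\<le>N. (cmod (p i))\<^sup>2) = 1 + S + (cmod c)\<^sup>2"
  proof -
    have "(\<Sum>i\<le>N. (cmod (p i))\<^sup>2) = (\<Sum>j\<le>N. if j = 0 then 1 else
        if N < 2 * j then (cmod (b (N - j)))\<^sup>2 else if N = 2 * j then (cmod c)\<^sup>2 else 0)"
      by (intro sum.cong) (auto simp: p_def)
    then show ?thesis
      using sum_upper_half[OF N, of 1 "\<lambda>i. (cmod (b i))\<^sup>2" "(cmod c)\<^sup>2"]
      by (simp add: S_def nb c_def)
  qed
  have bN: "Re (b N) = cmod (a N)"
    by (simp add: b_def e)
  have "Re (L + (L - b N + q)) \<le> 1 + S + (cmod c)\<^sup>2"
    using class_B_quadratic_form[OF ef, where N = N and p = p] unfolding b Q P .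
  then have main: "cmod (a N) + S + 2 * Re (if even N then c * b h else 0) + Re q - (cmod c)\<^sup>2 \<le> 1"
    by (simp add: L bN)
  \<comment> \<open>With \<open>x\<close> and \<open>y\<close> as below, the linear term gives
    \<open>2 * x\<^sup>2 / (1 + y)\<close>, while \<open>q\<close> and the norm of \<open>c\<close>
    together cost at most \<open>x\<^sup>2 / (1 + y)\<close>.\<close>
  have "(if even N then (cmod (a (N div 2)))\<^sup>2 / (1 + cmod (a 0)) else 0) \<le>
      2 * Re (if even N then c * b h else 0) + Re q - (cmod c)\<^sup>2"
  proof (cases "even N")
    case True
    define x y where "x = cmod (a h)" and "y = cmod (a 0)"
    have y: "1 + y > 0"
      by (simp add: y_def add_pos_nonneg)
    have c: "c = cnj (b h) / of_real (1 + y)"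
      using True by (simp add: c_def y_def)
    have nc: "cmod c = x / (1 + y)"
      unfolding c using y by (simp add: norm_divide nb x_def del: of_real_add)
    have "c * b h = of_real (x\<^sup>2 / (1 + y))"
      by (simp add: c x_def nb[symmetric] complex_norm_square mult.commute del: of_real_power)
    then have "Re (c * b h) = x\<^sup>2 / (1 + y)"
      by simp
    moreover have "- Re q \<le> (x / (1 + y))\<^sup>2 * y"
    proof -
      have "- Re q \<le> cmod q"
        using abs_Re_le_cmod[of q] by linarith
      also have "cmod q = (x / (1 + y))\<^sup>2 * y"
        using True by (simp add: q_def norm_mult norm_power nc nb y_def)
      finally show ?thesis .
    qed
    moreover have "(x / (1 + y))\<^sup>2 * y + (x / (1 + y))\<^sup>2 = x\<^sup>2 / (1 + y)"
    proof -
      have "(x / (1 + y))\<^sup>2 * y + (x / (1 + y))\<^sup>2 = (x / (1 + y))\<^sup>2 * (1 + y)"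
        by (simp add: algebra_simps)
      then show ?thesis
        using y by (simp add: power2_eq_square)
    qed
    ultimately show ?thesis
      using True by (simp add: nc flip: h_def x_def y_def)
  next
    case False
    then show ?thesis
      by (simp add: c_def q_def)
  qed
  then show ?thesis
    using main unfolding S_def by linarith
qed

lemma class_B_coeff_le_1:
  assumes "f \<in> class_B"
  shows "cmod (taylor_coeff f n) \<le> 1"
proof (cases "n = 0")
  case True
  then show ?thesis
    using assms by (auto simp: taylor_coeff_def class_B_def)
next
  case False
  have "0 \<le> (\<Sum>i | 2 * i < n. (cmod (taylor_coeff f i))\<^sup>2)"
    by (intro sum_nonneg) auto
  moreover have "0 \<le> (if even n then (cmod (taylor_coeff f (n div 2)))\<^sup>2 / (1 + cmod (taylor_coeff f 0)) else 0)"
    by auto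
  ultimately show ?thesis
    using class_B_coeff_bound[OF assms, of n] False by linarith
qed

section \<open>Convergence and bounds for the series \<open>B1\<close> and \<open>A0\<close>\<close>

lemma class_B_summable:
  assumes "f \<in> class_B" "0 \<le> \<rho>" "\<rho> < 1"
  shows "summable (\<lambda>n. cmod (taylor_coeff f (Suc n)) * \<rho> ^ Suc n)"
    and "summable (\<lambda>n. (cmod (taylor_coeff f (Suc n)))\<^sup>2 * \<rho> ^ (2 * Suc n))"
proof -
  have g: "summable (\<lambda>n. \<rho> ^ Suc n)"
    using assms by (subst summable_Suc_iff) (simp add: summable_geometric)
  have le: "\<rho> ^ (2 * Suc n) \<le> \<rho> ^ Suc n" for n
    using assms by (intro power_decreasing) auto
  show "summable (\<lambda>n. cmod (taylor_coeff f (Suc n)) * \<rho> ^ Suc n)"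
    by (rule summable_comparison_test'[OF g, of 0])
      (use assms in \<open>auto simp: abs_mult intro!: mult_right_le_one_le mult_left_le_one_le class_B_coeff_le_1\<close>)
  show "summable (\<lambda>n. (cmod (taylor_coeff f (Suc n)))\<^sup>2 * \<rho> ^ (2 * Suc n))"
  proof (rule summable_comparison_test'[OF g, of 0])
    fix n :: nat
    have "(cmod (taylor_coeff f (Suc n)))\<^sup>2 * \<rho> ^ (2 * Suc n) \<le> 1 * \<rho> ^ Suc n"
      using assms by (intro mult_mono le power_le_one class_B_coeff_le_1) auto
    then show "norm ((cmod (taylor_coeff f (Suc n)))\<^sup>2 * \<rho> ^ (2 * Suc n)) \<le> \<rho> ^ Suc n"
      using assms by simp
  qed
qed

lemma A0_nonneg:
  assumes "f \<in> class_B" "0 \<le> \<rho>" "\<rho> < 1"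
  shows "0 \<le> A0 f \<rho>"
  unfolding A0_def using assms by (intro mult_nonneg_nonneg suminf_nonneg class_B_summable) auto

text \<open>The triangle inequality for the power series of \<open>f z - f 0\<close>; it serves as
  the lower bound on \<open>B1\<close> in the sharpness argument.\<close>

lemma B1_ge_norm_diff:
  assumes f: "f \<in> class_B" and z: "cmod z < 1"
  shows "cmod (f z - f 0) \<le> B1 f (cmod z)"
proof -
  have "f holomorphic_on ball 0 1"
    using f by (auto simp: class_B_def)
  from holomorphic_taylor_sums[OF this z]
  have "(\<lambda>n. taylor_coeff f (Suc n) * z ^ Suc n) sums (f z - f 0)"
    by (subst sums_Suc_iff) (simp add: taylor_coeff_def)
  then have "f z - f 0 = (\<Sum>n. taylor_coeff f (Suc n) * z ^ Suc n)"
    by (simp add: sums_iff)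
  moreover have "summable (\<lambda>n. cmod (taylor_coeff f (Suc n) * z ^ Suc n))"
    using class_B_summable(1)[OF f, of "cmod z"] z by (simp add: norm_mult norm_power)
  ultimately show ?thesis
    unfolding B1_def using summable_norm by (fastforce simp: norm_mult norm_power)
qed

text \<open>After weighting by \<open>\<rho> ^ N\<close> and summing, the square of
  \<open>a i\<close> is collected from every \<open>N > 2 * i\<close>, a geometric tail, and from
  \<open>N = 2 * i\<close> with weight \<open>w\<close>. Both sums are truncated, at
  \<open>K\<close> for \<open>i\<close> and at \<open>M\<close> for \<open>N\<close>; then
  \<open>M\<close> and afterwards \<open>K\<close> tend to infinity.\<close>

lemma B1_plus_A0_le:
  assumes f: "f \<in> class_B" and r: "0 \<le> \<rho>" "\<rho> < 1"
  shows "B1 f \<rho> + A0 f \<rho> \<le> (1 - (cmod (f 0))\<^sup>2) * (\<rho> / (1 - \<rho>))"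
proof -
  define a where "a n = cmod (taylor_coeff f n)" for n
  have a0: "a 0 = cmod (f 0)"
    by (simp add: a_def taylor_coeff_def)
  have a_nn: "0 \<le> a n" for n
    by (simp add: a_def)
  have a1: "a 0 \<le> 1"
    unfolding a_def by (rule class_B_coeff_le_1[OF f])
  define w where "w = 1 / (1 + a 0)"
  define G where "G i M = (\<Sum>N=Suc (2 * i)..M. \<rho> ^ N)" for i M :: nat
  \<comment> \<open>The term \<open>i = 0\<close> moves to the right side; subtracted terms with
    \<open>i > K\<close> are nonnegative and are dropped.\<close>
  have coeff: "a N * \<rho> ^ N + (\<Sum>i\<in>{1..K}. if 2 * i < N then (a i)\<^sup>2 * \<rho> ^ N else 0)
      + (\<Sum>i\<in>{1..K}. if N = 2 * i then (a i)\<^sup>2 * w * \<rho> ^ (2 * i) else 0) \<le> (1 - (a 0)\<^sup>2) * \<rho> ^ N"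
    if N: "N \<ge> 1" for N K
  proof -
    define S where "S = (\<Sum>i\<in>{1..K}. if 2 * i < N then (a i)\<^sup>2 else 0)"
    have "(\<Sum>i\<in>{1..K}. if N = 2 * i then (a i)\<^sup>2 * w else 0)
        \<le> (if even N then (a (N div 2))\<^sup>2 * w else 0)"
    proof -
      have "(\<Sum>i\<in>{1..K}. if N = 2 * i then (a i)\<^sup>2 * w else 0) =
          (\<Sum>i\<in>{1..K}. if i = N div 2 then (if even N then (a (N div 2))\<^sup>2 * w else 0) else 0)"
        by (intro sum.cong) auto
      then show ?thesis
        using a_nn[of 0] by (auto simp: w_def)
    qed
    moreover have "S + (a 0)\<^sup>2 \<le> (\<Sum>i | 2 * i < N. (a i)\<^sup>2)"
    proof -
      have fin: "finite {i. 2 * i < N}"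
        by (rule finite_subset[of _ "{..N}"]) auto
      have "S = (\<Sum>i\<in>{i\<in>{1..K}. 2 * i < N}. (a i)\<^sup>2)"
        unfolding S_def by (rule sum.inter_filter[symmetric]) simp
      then have "S + (a 0)\<^sup>2 = (\<Sum>i\<in>insert 0 {i\<in>{1..K}. 2 * i < N}. (a i)\<^sup>2)"
        by simp
      also have "\<dots> \<le> (\<Sum>i | 2 * i < N. (a i)\<^sup>2)"
        using N fin by (intro sum_mono2) auto
      finally show ?thesis .
    qed
    ultimately have "a N + S + (\<Sum>i\<in>{1..K}. if N = 2 * i then (a i)\<^sup>2 * w else 0) \<le> 1 - (a 0)\<^sup>2"
      using class_B_coeff_bound[OF f N, folded a_def] unfolding w_def
      by (simp split: if_splits)
    from mult_right_mono[OF this, of "\<rho> ^ N"] show ?thesis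
      using r unfolding S_def distrib_right sum_distrib_right
      by (simp add: if_distrib[of "\<lambda>x. x * _"] cong: if_cong)
  qed
  have geo: "(\<Sum>N=1..M. \<rho> ^ N) \<le> \<rho> / (1 - \<rho>)" for M
    using r by (cases "M = 0") (auto simp: sum_gp divide_right_mono)
  \<comment> \<open>The condition \<open>2 * K \<le> M\<close> ensures that \<open>N = 2 * i\<close>
    occurs in the outer sum for every \<open>i \<le> K\<close>.\<close>
  have part: "(\<Sum>N=1..K. a N * \<rho> ^ N) + (\<Sum>i=1..K. (a i)\<^sup>2 * (w * \<rho> ^ (2 * i) + G i M))
      \<le> (1 - (a 0)\<^sup>2) * (\<rho> / (1 - \<rho>))" if KM: "2 * K \<le> M" for K M
  proof -
    have "(\<Sum>i=1..K. (a i)\<^sup>2 * (w * \<rho> ^ (2 * i) + G i M)) =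
      (\<Sum>i=1..K. (\<Sum>N=1..M. if 2 * i < N then (a i)\<^sup>2 * \<rho> ^ N else 0) +
        (\<Sum>N=1..M. if N = 2 * i then (a i)\<^sup>2 * w * \<rho> ^ (2 * i) else 0))"
    proof (intro sum.cong refl)
      fix i assume i: "i \<in> {1..K}"
      have "{Suc (2 * i)..M} = {N \<in> {1..M}. 2 * i < N}"
        by auto
      then have "(a i)\<^sup>2 * G i M = (\<Sum>N\<in>{N \<in> {1..M}. 2 * i < N}. (a i)\<^sup>2 * \<rho> ^ N)"
        by (simp add: G_def sum_distrib_left)
      also have "\<dots> = (\<Sum>N=1..M. if 2 * i < N then (a i)\<^sup>2 * \<rho> ^ N else 0)"
        by (rule sum.inter_filter) simp
      finally show "(a i)\<^sup>2 * (w * \<rho> ^ (2 * i) + G i M) =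
        (\<Sum>N=1..M. if 2 * i < N then (a i)\<^sup>2 * \<rho> ^ N else 0) +
        (\<Sum>N=1..M. if N = 2 * i then (a i)\<^sup>2 * w * \<rho> ^ (2 * i) else 0)"
        using i KM by (simp add: distrib_left)
    qed
    also have "\<dots> = (\<Sum>N=1..M. (\<Sum>i\<in>{1..K}. if 2 * i < N then (a i)\<^sup>2 * \<rho> ^ N else 0)
        + (\<Sum>i\<in>{1..K}. if N = 2 * i then (a i)\<^sup>2 * w * \<rho> ^ (2 * i) else 0))"
      unfolding sum.distrib by (intro arg_cong2[of _ _ _ _ "(+)"] sum.swap)
    finally have "(\<Sum>N=1..K. a N * \<rho> ^ N) + (\<Sum>i=1..K. (a i)\<^sup>2 * (w * \<rho> ^ (2 * i) + G i M))
      \<le> (\<Sum>N=1..M. a N * \<rho> ^ N) + (\<Sum>N=1..M. (\<Sum>i\<in>{1..K}. if 2 * i < N then (a i)\<^sup>2 * \<rho> ^ N else 0)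
        + (\<Sum>i\<in>{1..K}. if N = 2 * i then (a i)\<^sup>2 * w * \<rho> ^ (2 * i) else 0))"
      using KM r a_nn by (intro add_mono sum_mono2) auto
    also have "\<dots> = (\<Sum>N=1..M. a N * \<rho> ^ N +
        (\<Sum>i\<in>{1..K}. if 2 * i < N then (a i)\<^sup>2 * \<rho> ^ N else 0)
        + (\<Sum>i\<in>{1..K}. if N = 2 * i then (a i)\<^sup>2 * w * \<rho> ^ (2 * i) else 0))"
      unfolding sum.distrib by simp
    also have "\<dots> \<le> (\<Sum>N=1..M. (1 - (a 0)\<^sup>2) * \<rho> ^ N)"
      by (intro sum_mono coeff) auto
    also have "\<dots> = (1 - (a 0)\<^sup>2) * (\<Sum>N=1..M. \<rho> ^ N)"
      by (simp add: sum_distrib_left)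
    also have "\<dots> \<le> (1 - (a 0)\<^sup>2) * (\<rho> / (1 - \<rho>))"
      using geo a1 a_nn by (intro mult_left_mono) (auto simp: power_le_one)
    finally show ?thesis .
  qed
  have G_lim: "(\<lambda>M. G i M) \<longlonglongrightarrow> \<rho> ^ (2 * i) * (\<rho> / (1 - \<rho>))" for i
  proof -
    have "(\<lambda>M. (\<rho> ^ Suc (2 * i) - \<rho> * \<rho> ^ M) / (1 - \<rho>)) \<longlonglongrightarrow>
        (\<rho> ^ Suc (2 * i) - \<rho> * 0) / (1 - \<rho>)"
      using r by (intro tendsto_intros LIMSEQ_power_zero) auto
    moreover have "\<forall>\<^sub>F M in sequentially. (\<rho> ^ Suc (2 * i) - \<rho> * \<rho> ^ M) / (1 - \<rho>) = G i M"
      using eventually_ge_at_top[of "Suc (2 * i)"]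
      by eventually_elim (use r in \<open>auto simp: G_def sum_gp\<close>)
    ultimately show ?thesis
      by (simp add: tendsto_cong mult_ac)
  qed
  have fin: "(\<Sum>n<K. a (Suc n) * \<rho> ^ Suc n) +
      (w + \<rho> / (1 - \<rho>)) * (\<Sum>n<K. (a (Suc n))\<^sup>2 * \<rho> ^ (2 * Suc n))
      \<le> (1 - (a 0)\<^sup>2) * (\<rho> / (1 - \<rho>))" for K
  proof -
    have "(\<Sum>N=1..K. a N * \<rho> ^ N) +
        (\<Sum>i=1..K. (a i)\<^sup>2 * (w * \<rho> ^ (2 * i) + \<rho> ^ (2 * i) * (\<rho> / (1 - \<rho>))))
        \<le> (1 - (a 0)\<^sup>2) * (\<rho> / (1 - \<rho>))"
    proof (rule tendsto_upperbound)
      show "(\<lambda>M. (\<Sum>N=1..K. a N * \<rho> ^ N) + (\<Sum>i=1..K. (a i)\<^sup>2 * (w * \<rho> ^ (2 * i) + G i M)))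
          \<longlonglongrightarrow> (\<Sum>N=1..K. a N * \<rho> ^ N) +
        (\<Sum>i=1..K. (a i)\<^sup>2 * (w * \<rho> ^ (2 * i) + \<rho> ^ (2 * i) * (\<rho> / (1 - \<rho>))))"
        by (intro tendsto_intros G_lim)
      show "\<forall>\<^sub>F M in sequentially. (\<Sum>N=1..K. a N * \<rho> ^ N) +
          (\<Sum>i=1..K. (a i)\<^sup>2 * (w * \<rho> ^ (2 * i) + G i M)) \<le> (1 - (a 0)\<^sup>2) * (\<rho> / (1 - \<rho>))"
        using eventually_ge_at_top[of "2 * K"] by eventually_elim (rule part)
    qed simp
    moreover have "(\<Sum>N=1..K. h N) = (\<Sum>n<K. h (Suc n))" for h :: "nat \<Rightarrow> real"
      by (simp add: sum.atLeast1_atMost_eq)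
    ultimately show ?thesis
      unfolding sum_distrib_left by (simp add: algebra_simps)
  qed
  have "(\<lambda>K. (\<Sum>n<K. a (Suc n) * \<rho> ^ Suc n) +
      (w + \<rho> / (1 - \<rho>)) * (\<Sum>n<K. (a (Suc n))\<^sup>2 * \<rho> ^ (2 * Suc n))) \<longlonglongrightarrow> B1 f \<rho> + A0 f \<rho>"
    unfolding B1_def A0_def a_def w_def
    by (intro tendsto_intros summable_LIMSEQ class_B_summable f r)
  from tendsto_upperbound[OF this] show ?thesis
    using fin by (simp add: a0)
qed

subsection \<open>Schwarz lemmas\<close>

text \<open>Splitting off a zero at the origin stays inside the class, so zeros of higher order can
  be removed one at a time.\<close>

lemma class_B_schwarz_factor:
  assumes f: "f \<in> class_B" and f0: "f 0 = 0"
  obtains h where "h \<in> class_B" "\<And>z. cmod z < 1 \<Longrightarrow> f z = z * h z"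
proof -
  have hol: "f holomorphic_on ball 0 1" and bd: "\<And>z. cmod z < 1 \<Longrightarrow> cmod (f z) \<le> 1"
    using f by (auto simp: class_B_def)
  obtain h where h: "h holomorphic_on ball 0 1" "\<And>z. cmod z < 1 \<Longrightarrow> f z = z * h z"
      "deriv f 0 = h 0"
    using Schwarz3[OF hol f0] by metis
  have f': "deriv f 0 = taylor_coeff f 1"
    by (simp add: taylor_coeff_def)
  \<comment> \<open>\<open>Schwarz_Lemma\<close> asks for a strict bound by 1, which holds for
    \<open>c * f\<close> with \<open>c < 1\<close>; afterwards \<open>c\<close> tends to 1.\<close>
  have scaled: "c * cmod (f z) \<le> cmod z" if c: "0 < c" "c < 1" and z: "cmod z < 1" for c z
  proof -
    have "cmod (of_real c * f z) \<le> cmod z"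
    proof (rule Schwarz_Lemma(1))
      show "(\<lambda>z. of_real c * f z) holomorphic_on ball 0 1"
        by (intro holomorphic_intros hol)
      fix y assume "cmod y < 1"
      then have "c * cmod (f y) \<le> c * 1"
        using c by (intro mult_left_mono bd) auto
      then show "cmod (of_real c * f y) < 1"
        using c by (simp add: norm_mult less_le_trans[of _ c] le_less_trans[of _ c])
    qed (use f0 z in auto)
    then show ?thesis
      using c by (simp add: norm_mult)
  qed
  have le: "cmod (f z) \<le> cmod z" if z: "cmod z < 1" for z
    using field_le_mult_one_interval[of "cmod (f z)" "cmod z"] scaled z by blast
  have "cmod (h z) \<le> 1" if "cmod z < 1" for z
  proof (cases "z = 0")
    case True
    then show ?thesis
      using class_B_coeff_le_1[OF f, of 1] h(3) f' by simp
  next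
    case False
    then show ?thesis
      using le[OF that] h(2)[OF that] by (simp add: norm_mult)
  qed
  then have "h \<in> class_B"
    using h(1) by (simp add: class_B_def)
  then show ?thesis
    using h(2) by (rule that)
qed

text \<open>Induction on \<open>n\<close>: dividing by \<open>z\<close> shifts the coefficients by
  one, so the quotient has one vanishing coefficient fewer.\<close>

lemma class_B_schwarz_order:
  assumes "f \<in> class_B" "\<And>j. j < n \<Longrightarrow> taylor_coeff f j = 0" "cmod z < 1"
  shows "cmod (f z) \<le> cmod z ^ n"
  using assms(1,2)
proof (induction n arbitrary: f)
  case 0
  then show ?case
    using assms(3) by (simp add: class_B_def)
next
  case (Suc n)
  have "f 0 = 0"
    using Suc.prems(2)[of 0] by (simp add: taylor_coeff_def)
  then obtain h where h: "h \<in> class_B" "\<And>z. cmod z < 1 \<Longrightarrow> f z = z * h z"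
    using class_B_schwarz_factor Suc.prems(1) by metis
  have holh: "h holomorphic_on ball 0 1" and holf: "f holomorphic_on ball 0 1"
    using h(1) Suc.prems(1) by (auto simp: class_B_def)
  have "taylor_coeff f (Suc j) = taylor_coeff h j" for j
  proof -
    have "(deriv ^^ Suc j) f 0 = (deriv ^^ Suc j) (\<lambda>z. z ^ 1 * h z) 0"
      by (rule higher_deriv_transform_within_open[of _ "ball 0 1"])
        (auto intro!: holomorphic_intros holh holf h(2))
    then have "taylor_coeff f (Suc j) = taylor_coeff (\<lambda>z. z ^ 1 * h z) (Suc j)"
      by (simp only: taylor_coeff_def)
    then show ?thesis
      by (simp only: taylor_coeff_power_mult[OF holh]) simp
  qed
  then have "cmod (h z) \<le> cmod z ^ n"
    using Suc.prems(2) by (intro Suc.IH h(1)) (metis Suc_mono)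
  then show ?case
    using h(2)[OF assms(3)] by (simp add: norm_mult mult_left_mono)
qed

lemma class_Bn_bound:
  assumes "w \<in> class_Bn n" "cmod z < 1"
  shows "cmod (w z) \<le> cmod z ^ n"
  using assms by (intro class_B_schwarz_order) (auto simp: class_Bn_def taylor_coeff_def)

text \<open>The disc automorphism sending \<open>f 0\<close> to 0 turns \<open>f\<close> into a
  function \<open>g\<close> to which the Schwarz lemma applies; the estimate for \<open>g z\<close>
  is then solved for the modulus of \<open>f z\<close>.\<close>

lemma schwarz_pick_origin:
  assumes f: "f \<in> class_B" and z: "cmod z < 1"
  shows "cmod (f z) \<le> (cmod (f 0) + cmod z) / (1 + cmod (f 0) * cmod z)"
proof -
  have hol: "f holomorphic_on ball 0 1" and bd: "\<And>z. cmod z < 1 \<Longrightarrow> cmod (f z) \<le> 1"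
    using f by (auto simp: class_B_def)
  define a x s where "a = cmod (f 0)" and "x = cmod (f z)" and "s = cmod z"
  have as: "0 \<le> a" "0 \<le> s" "0 \<le> x" "x \<le> 1" "a \<le> 1"
    using bd[OF z] bd[of 0] by (auto simp: a_def s_def x_def)
  have "x * (1 + a * s) \<le> a + s"
  \<comment> \<open>For \<open>a = 1\<close> the automorphism degenerates, but the claim is just
    \<open>x \<le> 1\<close>.\<close>
  proof (cases "a = 1")
    case True
    have "x * (1 + s) \<le> 1 * (1 + s)"
      using as by (intro mult_right_mono) auto
    with True show ?thesis by simp
  next
    case False
    then have a: "a < 1"
      using as by simp
    define D where "D y = 1 - cnj (f 0) * f y" for y
    have id: "(cmod (D y))\<^sup>2 - (cmod (f y - f 0))\<^sup>2 = (1 - a\<^sup>2) * (1 - (cmod (f y))\<^sup>2)" for y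
      unfolding D_def a_def cmod_power2 by (simp add: power2_eq_square algebra_simps)
    have D0: "D y \<noteq> 0" if "cmod y < 1" for y
    proof
      assume "D y = 0"
      then have "1 = cmod (cnj (f 0) * f y)"
        by (simp add: D_def)
      also have "\<dots> \<le> a * 1"
        unfolding norm_mult a_def complex_mod_cnj using bd[OF that] by (intro mult_left_mono) auto
      finally show False
        using a by simp
    qed
    define g where "g y = (f y - f 0) / D y" for y
    have "g \<in> class_B"
    proof -
      have "g holomorphic_on ball 0 1"
        unfolding g_def D_def by (intro holomorphic_intros hol) (use D0 in \<open>auto simp: D_def\<close>)
      moreover have "cmod (g y) \<le> 1" if y: "cmod y < 1" for y
      proof -
        have "0 \<le> (1 - a\<^sup>2) * (1 - (cmod (f y))\<^sup>2)"
          using as bd[OF y] by (intro mult_nonneg_nonneg) (auto simp: power_le_one)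
        then have "(cmod (f y - f 0))\<^sup>2 \<le> (cmod (D y))\<^sup>2"
          using id[of y] by linarith
        then have "cmod (f y - f 0) \<le> cmod (D y)"
          by (rule power2_le_imp_le) simp
        then show ?thesis
          using D0[OF y] by (simp add: g_def norm_divide)
      qed
      ultimately show ?thesis
        by (auto simp: class_B_def)
    qed
    moreover have "g 0 = 0"
      by (simp add: g_def)
    ultimately have "cmod (g z) \<le> cmod z ^ 1"
      by (intro class_B_schwarz_order z) (auto simp: taylor_coeff_def)
    then have "cmod (f z - f 0) \<le> s * cmod (D z)"
      using D0[OF z] by (simp add: g_def s_def norm_divide field_simps)
    then have "(cmod (f z - f 0))\<^sup>2 \<le> s\<^sup>2 * (cmod (D z))\<^sup>2"
      by (simp flip: power_mult_distrib add: power_mono)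
    then have 1: "(1 - s\<^sup>2) * (cmod (D z))\<^sup>2 \<le> (1 - a\<^sup>2) * (1 - x\<^sup>2)"
      using id[of z] by (simp add: x_def algebra_simps)
    have ax: "a * x \<le> 1"
      using as by (simp add: mult_le_one)
    have "1 - a * x \<le> cmod (D z)"
      using norm_triangle_ineq2[of 1 "cnj (f 0) * f z"]
      by (simp add: D_def a_def x_def norm_mult)
    then have "(1 - s\<^sup>2) * (1 - a * x)\<^sup>2 \<le> (1 - s\<^sup>2) * (cmod (D z))\<^sup>2"
      using as z ax by (intro mult_left_mono power_mono) (auto simp: s_def power_le_one)
    \<comment> \<open>Uses \<open>(1 - a\<^sup>2) * (1 - x\<^sup>2) = (1 - a * x)\<^sup>2 - (x -
      a)\<^sup>2\<close>.\<close>
    with 1 have "(x - a)\<^sup>2 \<le> (s * (1 - a * x))\<^sup>2"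
      by (simp add: power2_eq_square algebra_simps)
    then have "x - a \<le> s * (1 - a * x)"
      using as ax by (auto intro: power2_le_imp_le)
    then show ?thesis
      by (simp add: algebra_simps)
  qed
  moreover have "0 < 1 + a * s"
    using as by (simp add: add_pos_nonneg)
  ultimately show ?thesis
    by (simp add: pos_le_divide_eq flip: a_def x_def s_def)
qed

subsection \<open>The radius\<close>

text \<open>Weighted AM-GM for \<open>x\<^sup>2\<close> and \<open>1\<close> with weights
  \<open>p / 2\<close> and \<open>1 - p / 2\<close>; the latter is nonnegative because
  \<open>p \<le> 2\<close>.\<close>

lemma one_minus_powr_ge:
  fixes x p :: real
  assumes "0 \<le> x" "0 < p" "p \<le> 2"
  shows "p / 2 * (1 - x\<^sup>2) \<le> 1 - x powr p"
proof (cases "x = 0")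
  case True
  with assms show ?thesis by simp
next
  case False
  then have le: "(x powr 2) powr (p / 2) * 1 powr (1 - p / 2) \<le> p / 2 * x powr 2 + (1 - p / 2) * 1"
    using assms by (intro Youngs_inequality_0) auto
  have "(x powr 2) powr (p / 2) = x powr p" "x powr 2 = x\<^sup>2"
    using assms by (auto simp: powr_powr simp del: powr_numeral) simp
  with le show ?thesis
    by (simp add: algebra_simps)
qed

text \<open>For the fraction \<open>x\<close>, \<open>1 - x\<^sup>2\<close> equals
  \<open>(1 - a\<^sup>2) * (1 - s\<^sup>2) / (1 + a * s)\<^sup>2\<close>, which is smallest relative
  to \<open>1 - a\<^sup>2\<close> at \<open>a = 1\<close>. With \<open>s = r ^ m\<close> and
  \<open>t = r ^ k / (1 - r ^ k)\<close>, \<open>T\<close> says that \<open>Psi3\<close> is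
  nonnegative at \<open>r\<close>.\<close>

lemma bohr_scalar_bound:
  fixes a s t p lam :: real
  assumes p: "0 < p" "p \<le> 2" and a: "0 \<le> a" "a \<le> 1" and s: "0 \<le> s" "s < 1"
    and T: "2 * lam * t \<le> p * ((1 - s) / (1 + s))"
  shows "((a + s) / (1 + a * s)) powr p + lam * ((1 - a\<^sup>2) * t) \<le> 1"
proof -
  define x where "x = (a + s) / (1 + a * s)"
  have pos: "0 < 1 + a * s"
    using a s by (simp add: add_pos_nonneg)
  have x: "0 \<le> x"
    using a s pos by (simp add: x_def)
  have a2: "0 \<le> 1 - a\<^sup>2"
    using a by (simp add: power_le_one)
  have "(1 - a\<^sup>2) * ((1 - s) / (1 + s)) = (1 - a\<^sup>2) * (1 - s\<^sup>2) / (1 + s)\<^sup>2"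
    using s by (simp add: divide_simps) (simp add: power2_eq_square algebra_simps)
  also have "\<dots> \<le> (1 - a\<^sup>2) * (1 - s\<^sup>2) / (1 + a * s)\<^sup>2"
    using a s pos a2 mult_right_mono[of a 1 s]
    by (intro divide_left_mono power_mono mult_nonneg_nonneg) (auto simp: power_le_one)
  also have "\<dots> = 1 - x\<^sup>2"
    using pos by (simp add: x_def power_divide diff_divide_eq_iff) (simp add: power2_eq_square algebra_simps)
  finally have 1: "(1 - a\<^sup>2) * ((1 - s) / (1 + s)) \<le> 1 - x\<^sup>2" .
  have "lam * ((1 - a\<^sup>2) * t) = (1 - a\<^sup>2) / 2 * (2 * lam * t)"
    by simp
  also have "\<dots> \<le> (1 - a\<^sup>2) / 2 * (p * ((1 - s) / (1 + s)))"
    using a2 by (intro mult_left_mono T) auto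
  also have "\<dots> = p / 2 * ((1 - a\<^sup>2) * ((1 - s) / (1 + s)))"
    by simp
  also have "\<dots> \<le> p / 2 * (1 - x\<^sup>2)"
    using p by (intro mult_left_mono 1) auto
  also have "\<dots> \<le> 1 - x powr p"
    by (rule one_minus_powr_ge[OF x p])
  finally show ?thesis
    by (simp add: x_def)
qed

section \<open>Monotonicity of \<open>Psi3\<close> and its unique root\<close>

lemma Psi3_strict_decreasing:
  assumes "k \<ge> 1" "m \<ge> 1" "0 < p" "0 < lam" "0 \<le> r" "r < s" "s < 1"
  shows "Psi3 k m lam p s < Psi3 k m lam p r"
proof -
  have k: "r ^ k < s ^ k" "s ^ k < 1" "0 \<le> r ^ k" and m: "r ^ m < s ^ m" "s ^ m < 1" "0 \<le> r ^ m"
    using assms by (auto intro!: power_strict_mono simp: power_less_one_iff)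
  have "r ^ k / (1 - r ^ k) < s ^ k / (1 - s ^ k)"
    using k by (simp add: divide_simps) (simp add: algebra_simps)
  moreover have "(1 - s ^ m) / (1 + s ^ m) < (1 - r ^ m) / (1 + r ^ m)"
    using m by (simp add: divide_simps) (simp add: algebra_simps)
  ultimately show ?thesis
    unfolding Psi3_def using assms by (intro diff_strict_mono mult_strict_left_mono) auto
qed

lemma Psi3_ex1_root:
  assumes "k \<ge> 1" "m \<ge> 1" "0 < p" "0 < lam"
  shows "\<exists>!r. 0 < r \<and> r < 1 \<and> Psi3 k m lam p r = 0"
proof -
  have neg: "\<exists>b. 0 < b \<and> b < 1 \<and> Psi3 k m lam p b < 0"
  proof -
    \<comment> \<open>Chosen so that \<open>lam * (t / (1 - t)) = p\<close>: at the
      \<open>k\<close>-th root of \<open>t\<close> the subtracted term is \<open>2 * p\<close>,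
      while the first term is at most \<open>p\<close>.\<close>
    define t where "t = p / (p + lam)"
    have t: "0 < t" "t < 1"
      using assms by (auto simp: t_def)
    define b where "b = root k t"
    have b: "b ^ k = t" "0 < b" "b < 1"
      using assms t by (auto simp: b_def)
    have "(1 - b ^ m) / (1 + b ^ m) \<le> 1"
      using b by (simp add: divide_simps add_pos_pos)
    then have "p * ((1 - b ^ m) / (1 + b ^ m)) \<le> p * 1"
      using assms by (intro mult_left_mono) auto
    moreover have "lam * (t / (1 - t)) = p"
    proof -
      have "1 - t = lam / (p + lam)"
        using assms by (simp add: t_def field_simps)
      then show ?thesis
        using assms by (simp add: t_def)
    qed
    ultimately have "Psi3 k m lam p b < 0"
      using assms by (simp add: Psi3_def b)
    with b show ?thesis by blast
  qed
  then obtain b where b: "0 < b" "b < 1" "Psi3 k m lam p b < 0"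
    by blast
  have P0: "Psi3 k m lam p 0 > 0"
    using assms by (simp add: Psi3_def power_0_left)
  have "continuous_on {0..b} (Psi3 k m lam p)"
  proof -
    have "r ^ k < 1" if "r \<in> {0..b}" for r
      using that b assms by (simp add: power_less_one_iff)
    moreover have "0 \<le> r ^ m" if "r \<in> {0..b}" for r
      using that by simp
    ultimately show ?thesis
      unfolding Psi3_def by (intro continuous_intros) (fastforce simp: add_nonneg_eq_0_iff)+
  qed
  with IVT2'[of "Psi3 k m lam p" b 0 0] b P0
  obtain r where r: "0 \<le> r" "r \<le> b" "Psi3 k m lam p r = 0"
    by auto
  have "0 < r"
    using r P0 by (cases "r = 0") auto
  show ?thesis
  proof (rule ex1I[of _ r])
    show "0 < r \<and> r < 1 \<and> Psi3 k m lam p r = 0"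
      using \<open>0 < r\<close> r b by auto
    fix s assume s: "0 < s \<and> s < 1 \<and> Psi3 k m lam p s = 0"
    show "s = r"
      using Psi3_strict_decreasing[OF assms, of r s] Psi3_strict_decreasing[OF assms, of s r] s r b
      by (cases s r rule: linorder_cases) auto
  qed
qed

lemma R3_root:
  assumes "k \<ge> 1" "m \<ge> 1" "0 < p" "0 < lam"
  shows "0 < R3 k m lam p" "R3 k m lam p < 1" "Psi3 k m lam p (R3 k m lam p) = 0"
  using theI'[OF Psi3_ex1_root[OF assms]] by (auto simp: R3_def)

text \<open>The bounds for \<open>f\<close> and for \<open>B1 + A0\<close> involve only the modulus
  of \<open>f 0\<close> and increase with the moduli of \<open>\<omega> m z\<close> and
  \<open>\<omega> k z\<close>, so these may be replaced by \<open>r ^ m\<close> and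
  \<open>r ^ k\<close>.\<close>

lemma C_fun_le_1:
  assumes km: "k \<ge> 1" "m \<ge> 1" and p: "0 < p" "p \<le> 2" and lam: "0 < lam"
    and f: "f \<in> class_B" and w: "\<omega> k \<in> class_Bn k" "\<omega> m \<in> class_Bn m"
    and z: "cmod z \<le> R3 k m lam p"
  shows "C_fun k m lam p f \<omega> z \<le> 1"
proof -
  define r where "r = cmod z"
  have r: "0 \<le> r" "r < 1"
    using z R3_root[OF km p(1) lam] by (auto simp: r_def)
  have Psi: "0 \<le> Psi3 k m lam p r"
    using Psi3_strict_decreasing[OF km p(1) lam r(1), of "R3 k m lam p"] R3_root[OF km p(1) lam] z
    by (cases "r = R3 k m lam p") (auto simp: r_def)
  define \<rho> where "\<rho> = cmod (\<omega> k z)"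
  define \<sigma> where "\<sigma> = cmod (\<omega> m z)"
  have rk: "r ^ k < 1" and rm: "r ^ m < 1"
    using r km by (auto simp: power_less_one_iff)
  have rho: "\<rho> \<le> r ^ k" "0 \<le> \<rho>" and sigma: "\<sigma> \<le> r ^ m" "0 \<le> \<sigma>"
    using class_Bn_bound[OF w(1), of z] class_Bn_bound[OF w(2), of z] r
    by (auto simp: r_def \<rho>_def \<sigma>_def)
  define a where "a = cmod (f 0)"
  have a: "0 \<le> a" "a \<le> 1"
    using f by (auto simp: a_def class_B_def)
  have "cmod (f (\<omega> m z)) \<le> (a + \<sigma>) / (1 + a * \<sigma>)"
    using schwarz_pick_origin[OF f, of "\<omega> m z"] sigma rm by (simp add: \<sigma>_def a_def)
  also have "\<dots> \<le> (a + r ^ m) / (1 + a * r ^ m)"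
  proof -
    have "0 < 1 + a * \<sigma>" "0 < 1 + a * r ^ m"
      using a sigma r by (auto simp: add_pos_nonneg)
    moreover have "0 \<le> (1 - a\<^sup>2) * (r ^ m - \<sigma>)"
      using a sigma by (simp add: power_le_one)
    ultimately show ?thesis
      by (simp add: frac_le_eq divide_le_0_iff) (simp add: power2_eq_square algebra_simps)
  qed
  finally have 1: "cmod (f (\<omega> m z)) powr p \<le> ((a + r ^ m) / (1 + a * r ^ m)) powr p"
    using p by (intro powr_mono2) auto
  have "B1 f \<rho> + A0 f \<rho> \<le> (1 - a\<^sup>2) * (\<rho> / (1 - \<rho>))"
    using B1_plus_A0_le[OF f, of \<rho>] rho rk by (simp add: a_def)
  also have "\<dots> \<le> (1 - a\<^sup>2) * (r ^ k / (1 - r ^ k))"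
    using a rho rk by (intro mult_left_mono frac_le) (auto simp: power_le_one)
  finally have 2: "lam * (B1 f \<rho> + A0 f \<rho>) \<le> lam * ((1 - a\<^sup>2) * (r ^ k / (1 - r ^ k)))"
    using lam by (intro mult_left_mono) auto
  have "((a + r ^ m) / (1 + a * r ^ m)) powr p + lam * ((1 - a\<^sup>2) * (r ^ k / (1 - r ^ k))) \<le> 1"
    using Psi r rm by (intro bohr_scalar_bound p a) (auto simp: Psi3_def)
  with 1 2 show ?thesis
    unfolding C_fun_def \<rho>_def by linarith
qed

subsection \<open>Sharpness\<close>

lemma power_in_class_Bn: "(\<lambda>z. z ^ n) \<in> class_Bn n"
proof -
  \<comment> \<open>The factor \<open>0 ^ (n - j)\<close> vanishes for \<open>j < n\<close>; for
    \<open>j = n\<close> the Pochhammer symbol is \<open>fact n\<close>.\<close>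
  have "(deriv ^^ j) (\<lambda>z::complex. z ^ n) 0 = pochhammer (of_nat (Suc n - j)) j * 0 ^ (n - j)" for j
    using higher_deriv_power[of j 0 n 0] by simp
  then show ?thesis
    by (auto simp: class_Bn_def class_B_def norm_power power_le_one pochhammer_fact[symmetric]
        intro!: holomorphic_intros)
qed

lemma moebius_in_class_B:
  fixes a :: real
  assumes "0 \<le> a" "a < 1"
  shows "(\<lambda>z. (of_real a + z) / (1 + of_real a * z)) \<in> class_B"
proof -
  have nz: "1 + of_real a * z \<noteq> 0" if "cmod z < 1" for z
  proof
    assume "1 + of_real a * z = 0"
    then have "1 = cmod (of_real a * z)"
      by (metis add_eq_0_iff norm_minus_cancel norm_one)
    also have "\<dots> < 1"
      using assms that mult_strict_mono[of a 1 "cmod z" 1] by (simp add: norm_mult)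
    finally show False by simp
  qed
  have "cmod (of_real a + z) \<le> cmod (1 + of_real a * z)" if "cmod z < 1" for z
  proof -
    have "(cmod (1 + of_real a * z))\<^sup>2 - (cmod (of_real a + z))\<^sup>2 = (1 - a\<^sup>2) * (1 - (cmod z)\<^sup>2)"
      unfolding cmod_power2 by (simp add: power2_eq_square algebra_simps)
    moreover have "0 \<le> (1 - a\<^sup>2) * (1 - (cmod z)\<^sup>2)"
      using assms that by (intro mult_nonneg_nonneg) (auto simp: power_le_one)
    ultimately have "(cmod (of_real a + z))\<^sup>2 \<le> (cmod (1 + of_real a * z))\<^sup>2"
      by linarith
    then show ?thesis
      by (rule power2_le_imp_le) simp
  qed
  then show ?thesis
    using nz by (auto simp: class_B_def norm_divide divide_le_eq_1 intro!: holomorphic_intros)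
qed

text \<open>
  \<open>B1 f t\<close> is bounded below by \<open>\<bar>f(-t) - f(0)\<bar>\<close>, which avoids computing the coefficients of \<open>f\<close>.
\<close>

lemma C_fun_moebius_ge:
  fixes a r :: real
  assumes a: "0 \<le> a" "a < 1" and r: "0 \<le> r" "r < 1" and k: "k \<ge> 1" and lam: "0 < lam"
  shows "((a + r ^ m) / (1 + a * r ^ m)) powr p + lam * ((1 - a\<^sup>2) * (r ^ k / (1 - a * r ^ k)))
    \<le> C_fun k m lam p (\<lambda>z. (of_real a + z) / (1 + of_real a * z)) (\<lambda>n z. z ^ n) (of_real r)"
proof -
  define f where "f z = (of_real a + z) / (1 + of_real a * z)" for z :: complex
  define t where "t = r ^ k"
  have f: "f \<in> class_B"
    unfolding f_def by (rule moebius_in_class_B[OF a])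
  have t: "0 \<le> t" "t < 1"
    using r k by (auto simp: t_def power_less_one_iff)
  have at: "0 < 1 - a * t"
    using a t mult_right_mono[of a 1 t] by simp
  have "f (of_real (r ^ m)) = of_real ((a + r ^ m) / (1 + a * r ^ m))"
    by (simp add: f_def)
  then have 1: "cmod (f (of_real r ^ m)) = (a + r ^ m) / (1 + a * r ^ m)"
    using a r by (simp only: norm_of_real of_real_power[symmetric]) simp
  \<comment> \<open>At \<open>-t\<close> all terms of the series of \<open>f - f 0\<close> have the
    same sign, so the triangle inequality loses nothing.\<close>
  have "f 0 - f (of_real (- t)) = of_real (a - (a - t) / (1 - a * t))"
    by (simp add: f_def)
  also have "a - (a - t) / (1 - a * t) = (1 - a\<^sup>2) * (t / (1 - a * t))"
    using at by (simp add: field_simps power2_eq_square)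
  finally have "cmod (f (of_real (- t)) - f 0) = (1 - a\<^sup>2) * (t / (1 - a * t))"
    using a t at by (subst norm_minus_commute) (simp only: norm_of_real, simp add: power_le_one)
  then have 2: "(1 - a\<^sup>2) * (t / (1 - a * t)) \<le> B1 f t"
    using B1_ge_norm_diff[OF f, of "of_real (- t)"] t by simp
  \<comment> \<open>Dropping \<open>A0\<close> is harmless to first order: it is of size
    \<open>(1 - a)\<^sup>2\<close> as \<open>a\<close> tends to 1.\<close>
  have 3: "0 \<le> A0 f t"
    by (rule A0_nonneg[OF f t])
  have nt: "cmod (of_real r ^ k) = t"
    using r by (simp add: t_def norm_power)
  have "lam * ((1 - a\<^sup>2) * (t / (1 - a * t))) \<le> lam * (B1 f t + A0 f t)"
    using lam 2 3 by (intro mult_left_mono) auto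
  then show ?thesis
    unfolding C_fun_def f_def[symmetric] 1 nt t_def[symmetric] by simp
qed

lemma C_fun_sharp:
  assumes k: "k \<ge> 1" and lam: "0 < lam" and r: "0 \<le> r" "r < 1" and neg: "Psi3 k m lam p r < 0"
  shows "\<exists>f\<in>class_B. C_fun k m lam p f (\<lambda>n z. z ^ n) (of_real r) > 1"
proof -
  define s t where "s = r ^ m" and "t = r ^ k"
  have s: "0 \<le> s" and t: "0 \<le> t" "t < 1"
    using r k by (auto simp: s_def t_def power_less_one_iff)
  \<comment> \<open>The lower bound as a function of \<open>a\<close>. It makes sense at
    \<open>a = 1\<close>, where the Moebius map degenerates, and is differentiated there.\<close>
  define \<phi> where "\<phi> a = ((a + s) / (1 + a * s)) powr p + lam * ((1 - a\<^sup>2) * (t / (1 - a * t)))" for a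
  have u: "((\<lambda>a. (a + s) / (1 + a * s)) has_real_derivative (1 - s) / (1 + s)) (at 1)"
  proof -
    have "((1 + s) - (1 + s) * s) / ((1 + s) * (1 + s)) = (1 - s) / (1 + s)"
    proof -
      have "(1 + s) - (1 + s) * s = (1 + s) * (1 - s)"
        by (simp add: algebra_simps)
      then show ?thesis
        using s by simp
    qed
    then show ?thesis
      using s by (auto intro!: derivative_eq_intros)
  qed
  have v: "((\<lambda>a. (1 - a\<^sup>2) * (t / (1 - a * t))) has_real_derivative - 2 * (t / (1 - t))) (at 1)"
    using t by (auto intro!: derivative_eq_intros)
  have "(\<phi> has_real_derivative p * ((1 + s) / (1 + 1 * s)) powr (p - of_nat 1) * ((1 - s) / (1 + s))
      + lam * (- 2 * (t / (1 - t)))) (at 1)"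
    unfolding \<phi>_def using s by (intro DERIV_add DERIV_cmult v DERIV_fun_powr u) auto
  moreover have "p * ((1 + s) / (1 + 1 * s)) powr (p - of_nat 1) * ((1 - s) / (1 + s))
      + lam * (- 2 * (t / (1 - t))) = Psi3 k m lam p r"
    using s by (simp add: Psi3_def s_def[symmetric] t_def[symmetric])
  ultimately have "(\<phi> has_real_derivative Psi3 k m lam p r) (at 1)"
    by simp
  from DERIV_neg_dec_left[OF this neg] obtain d where d: "d > 0"
      "\<And>h. 0 < h \<Longrightarrow> h < d \<Longrightarrow> \<phi> 1 < \<phi> (1 - h)"
    by blast
  \<comment> \<open>The bound \<open>1/2\<close> keeps \<open>1 - h\<close> inside
    \<open>(0, 1)\<close>, as the Moebius map requires.\<close>
  define h where "h = min (1/2) (d / 2)"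
  have h: "0 < h" "h < d" "h < 1"
    using d by (auto simp: h_def)
  have "\<phi> 1 = 1"
    using s by (simp add: \<phi>_def)
  with d h have "1 < \<phi> (1 - h)"
    by force
  with C_fun_moebius_ge[of "1 - h" r k lam m p] h r k lam moebius_in_class_B[of "1 - h"]
  show ?thesis
    unfolding \<phi>_def s_def t_def by (intro bexI) auto
qed

theorem theorem3:
  fixes k m :: nat and p lam :: real
  assumes "k \<ge> 1" and "m \<ge> 1" and "0 < p" and "p \<le> 2" and "0 < lam"
  shows "(\<exists>!r. 0 < r \<and> r < 1 \<and> Psi3 k m lam p r = 0) \<and>
    (\<forall>f \<omega> z. f \<in> class_B \<longrightarrow> (\<forall>n\<ge>1. \<omega> n \<in> class_Bn n) \<longrightarrow>
        cmod z \<le> R3 k m lam p \<longrightarrow> C_fun k m lam p f \<omega> z \<le> 1) \<and>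
    (\<forall>R. R3 k m lam p < R \<longrightarrow> R < 1 \<longrightarrow>
        (\<exists>f \<omega> z. f \<in> class_B \<and> (\<forall>n\<ge>1. \<omega> n \<in> class_Bn n) \<and>
           cmod z \<le> R \<and> C_fun k m lam p f \<omega> z > 1))"
proof (intro conjI allI impI)
  show "\<exists>!r. 0 < r \<and> r < 1 \<and> Psi3 k m lam p r = 0"
    by (rule Psi3_ex1_root) fact+
next
  fix f \<omega> z
  assume "f \<in> class_B" "\<forall>n\<ge>1. \<omega> n \<in> class_Bn n" "cmod z \<le> R3 k m lam p"
  then show "C_fun k m lam p f \<omega> z \<le> 1"
    using assms by (intro C_fun_le_1) auto
next
  fix R
  assume R: "R3 k m lam p < R" "R < 1"
  note root = R3_root[OF assms(1-3,5)]
  have "Psi3 k m lam p R < 0"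
    using Psi3_strict_decreasing[OF assms(1-3,5) _ R] root by simp
  then obtain f where "f \<in> class_B" "C_fun k m lam p f (\<lambda>n z. z ^ n) (of_real R) > 1"
    using C_fun_sharp[OF assms(1,5), of R] R root by auto
  moreover have "cmod (of_real R) \<le> R"
    using R root by simp
  ultimately show "\<exists>f \<omega> z. f \<in> class_B \<and> (\<forall>n\<ge>1. \<omega> n \<in> class_Bn n) \<and>
      cmod z \<le> R \<and> C_fun k m lam p f \<omega> z > 1"
    using power_in_class_Bn
    by (intro exI[of _ f] exI[of _ "\<lambda>n z. z ^ n"] exI[of _ "of_real R"]) auto
qed

end
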